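(* For the pure coalition-modal language over the fixed finite set of coalition labels $2^N$, for every formula $\varphi$: $\mathsf H_{\mathrm{bp}}\vdash\varphi$ if and only if $\varphi$ is valid on every frame in $\mathsf{Dev}(N)$. Equivalently, every $\mathsf H_{\mathrm{bp}}$-consistent formula is satisfiable in the canonical model of $\mathsf H_{\mathrm{bp}}$, whose frame lies in $\mathsf{Dev}(N)$.
   Context: $N$ is a fixed finite set of agents. The pure coalition-modal language has arbitrary propositional letters, $\neg$, $\wedge$, and for each $C\subseteq N$ a diamond $\langle C\rangle$, with $[C]\varphi:=\neg\langle C\rangle\neg\varphi$; $\langle C\rangle$ is interpreted by a relation $E_C$ in the usual Kripke way. $\mathsf H_{\mathrm{bp}}$ is the smallest normal multimodal logic (tautologies, modus ponens, necessitation for each $[C]$) containing, for all $C,D\subseteq N$: $[C](\varphi\to\psi)\to([C]\varphi\to[C]\psi)$; $[C]\varphi\to\varphi$; $[\emptyset]\varphi\leftrightarrow\varphi$; $[C]\varphi\to[C][C]\varphi$; $\neg[C]\varphi\to[C]\neg[C]\varphi$; $\langle C\rangle\varphi\to\langle D\rangle\varphi$ when $C\subseteq D$; $\langle C\rangle\langle D\rangle\varphi\leftrightarrow\langle C\cup D\rangle\varphi$. $\mathsf{Dev}(N)$ is the class of frames $(S,\{E_C\}_{C\subseteq N})$ such that each $E_C$ is an equivalence relation, $E_\emptyset$ is the identity on $S$, $E_C\subseteq E_D$ whenever $C\subseteq D$, and $E_C\circ E_D=E_{C\cup D}$ for all $C,D$, where $s(E_C\circ E_D)t$ iff $\exists u\,(sE_Cu\wedge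 uE_Dt)$.
   Formalization: The logic H_bp is taken to include the duality axiom ⟨C⟩φ ↔ ¬[C]¬φ, standard for normal logics with primitive diamonds; with only the listed axioms and rules, p → ⟨∅⟩p is valid but not provable. *)

theory Defs
  imports Main
begin

datatype ('p, 'a) fm =
    Atom 'p
  | Neg "('p, 'a) fm"
  | And "('p, 'a) fm" "('p, 'a) fm"
  | Dia "'a set" "('p, 'a) fm"

abbreviation Imp :: "('p, 'a) fm \<Rightarrow> ('p, 'a) fm \<Rightarrow> ('p, 'a) fm" where
  "Imp \<phi> \<psi> \<equiv> Neg (And \<phi> (Neg \<psi>))"

abbreviation Iff :: "('p, 'a) fm \<Rightarrow> ('p, 'a) fm \<Rightarrow> ('p, 'a) fm" where
  "Iff \<phi> \<psi> \<equiv> And (Imp \<phi> \<psi>) (Imp \<psi> \<phi>)"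

abbreviation Box :: "'a set \<Rightarrow> ('p, 'a) fm \<Rightarrow> ('p, 'a) fm" where
  "Box C \<phi> \<equiv> Neg (Dia C (Neg \<phi>))"

(* The agents form a finite set N :: 'a set (possibly empty), not a whole type.
   The language over N consists of the formulas all of whose labels are subsets of N. *)
primrec in_lang :: "'a set \<Rightarrow> ('p, 'a) fm \<Rightarrow> bool" where
  "in_lang N (Atom p) \<longleftrightarrow> True"
| "in_lang N (Neg \<phi>) \<longleftrightarrow> in_lang N \<phi>"
| "in_lang N (And \<phi> \<psi>) \<longleftrightarrow> in_lang N \<phi> \<and> in_lang N \<psi>"
| "in_lang N (Dia C \<phi>) \<longleftrightarrow> C \<subseteq> N \<and> in_lang N \<phi>"

definition lang :: "'a set \<Rightarrow> ('p, 'a) fm set" where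
  "lang N = {\<phi>. in_lang N \<phi>}"


(* Atoms and diamond formulas are the propositionally indecomposable formulas, so the
   formulas true under every such valuation are exactly the modal substitution instances
   of propositional tautologies. *)
primrec prop_eval :: "(('p, 'a) fm \<Rightarrow> bool) \<Rightarrow> ('p, 'a) fm \<Rightarrow> bool" where
  "prop_eval v (Atom p) \<longleftrightarrow> v (Atom p)"
| "prop_eval v (Neg \<phi>) \<longleftrightarrow> \<not> prop_eval v \<phi>"
| "prop_eval v (And \<phi> \<psi>) \<longleftrightarrow> prop_eval v \<phi> \<and> prop_eval v \<psi>"
| "prop_eval v (Dia C \<phi>) \<longleftrightarrow> v (Dia C \<phi>)"

definition tautology :: "('p, 'a) fm \<Rightarrow> bool" where
  "tautology \<phi> \<longleftrightarrow> (\<forall>v. prop_eval v \<phi>)"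

(* All axioms are schemas, so closure under uniform substitution is built in.
   Dual is part of what it means for a logic to be normal when the diamond is primitive
   and [C] abbreviates \<not><C>\<not>: without it, <C>p and <C>\<not>\<not>p would not be provably
   equivalent, since K and necessitation only speak about diamonds of negations. *)
inductive Hbp :: "'a set \<Rightarrow> ('p, 'a) fm \<Rightarrow> bool" for N :: "'a set" where
  Taut: "\<lbrakk>\<phi> \<in> lang N; tautology \<phi>\<rbrakk> \<Longrightarrow> Hbp N \<phi>"
| Dual: "\<lbrakk>C \<subseteq> N; \<phi> \<in> lang N\<rbrakk> \<Longrightarrow> Hbp N (Iff (Dia C \<phi>) (Neg (Box C (Neg \<phi>))))"
| K: "\<lbrakk>C \<subseteq> N; \<phi> \<in> lang N; \<psi> \<in> lang N\<rbrakk>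
    \<Longrightarrow> Hbp N (Imp (Box C (Imp \<phi> \<psi>)) (Imp (Box C \<phi>) (Box C \<psi>)))"
| T: "\<lbrakk>C \<subseteq> N; \<phi> \<in> lang N\<rbrakk> \<Longrightarrow> Hbp N (Imp (Box C \<phi>) \<phi>)"
| Empty: "\<phi> \<in> lang N \<Longrightarrow> Hbp N (Iff (Box {} \<phi>) \<phi>)"
| Four: "\<lbrakk>C \<subseteq> N; \<phi> \<in> lang N\<rbrakk> \<Longrightarrow> Hbp N (Imp (Box C \<phi>) (Box C (Box C \<phi>)))"
| Five: "\<lbrakk>C \<subseteq> N; \<phi> \<in> lang N\<rbrakk>
    \<Longrightarrow> Hbp N (Imp (Neg (Box C \<phi>)) (Box C (Neg (Box C \<phi>))))"
| Mono: "\<lbrakk>C \<subseteq> D; D \<subseteq> N; \<phi> \<in> lang N\<rbrakk> \<Longrightarrow> Hbp N (Imp (Dia C \<phi>) (Dia D \<phi>))"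
| Comp: "\<lbrakk>C \<subseteq> N; D \<subseteq> N; \<phi> \<in> lang N\<rbrakk>
    \<Longrightarrow> Hbp N (Iff (Dia C (Dia D \<phi>)) (Dia (C \<union> D) \<phi>))"
| MP: "\<lbrakk>Hbp N (Imp \<phi> \<psi>); Hbp N \<phi>\<rbrakk> \<Longrightarrow> Hbp N \<psi>"
| Nec: "\<lbrakk>C \<subseteq> N; Hbp N \<phi>\<rbrakk> \<Longrightarrow> Hbp N (Box C \<phi>)"


(* Only the relations E C with C \<subseteq> N belong to a frame for N; the values of E at
   other sets are irrelevant. *)
type_synonym ('a, 's) frame = "'s set \<times> ('a set \<Rightarrow> ('s \<times> 's) set)"

primrec sat ::
  "('a, 's) frame \<Rightarrow> ('p \<Rightarrow> 's set) \<Rightarrow> 's \<Rightarrow> ('p, 'a) fm \<Rightarrow> bool" where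
  "sat F V s (Atom p) \<longleftrightarrow> s \<in> V p"
| "sat F V s (Neg \<phi>) \<longleftrightarrow> \<not> sat F V s \<phi>"
| "sat F V s (And \<phi> \<psi>) \<longleftrightarrow> sat F V s \<phi> \<and> sat F V s \<psi>"
| "sat F V s (Dia C \<phi>) \<longleftrightarrow> (\<exists>t\<in>fst F. (s, t) \<in> snd F C \<and> sat F V t \<phi>)"

definition frame_valid :: "('a, 's) frame \<Rightarrow> ('p, 'a) fm \<Rightarrow> bool" where
  "frame_valid F \<phi> \<longleftrightarrow>
    (\<forall>V. (\<forall>p. V p \<subseteq> fst F) \<longrightarrow> (\<forall>s\<in>fst F. sat F V s \<phi>))"

definition Dev :: "'a set \<Rightarrow> ('a, 's) frame set" where
  "Dev N = {(S, E).
      S \<noteq> {}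
    \<and> (\<forall>C. C \<subseteq> N \<longrightarrow> equiv S (E C))
    \<and> E {} = Id_on S
    \<and> (\<forall>C D. C \<subseteq> D \<and> D \<subseteq> N \<longrightarrow> E C \<subseteq> E D)
    \<and> (\<forall>C D. C \<subseteq> N \<and> D \<subseteq> N \<longrightarrow> E C O E D = E (C \<union> D))}"

(* Validity on all frames in Dev(N) whose worlds are drawn from the type 's. *)
definition Dev_valid :: "'s itself \<Rightarrow> 'a set \<Rightarrow> ('p, 'a) fm \<Rightarrow> bool" where
  "Dev_valid _ N \<phi> \<longleftrightarrow> (\<forall>F \<in> (Dev N :: ('a, 's) frame set). frame_valid F \<phi>)"


(* foldr Imp [\<psi>1, ..., \<psi>n] \<phi> is \<psi>1 \<rightarrow> (... \<rightarrow> (\<psi>n \<rightarrow> \<phi>)). *)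
definition derives_from :: "'a set \<Rightarrow> ('p, 'a) fm set \<Rightarrow> ('p, 'a) fm \<Rightarrow> bool" where
  "derives_from N \<Gamma> \<phi> \<longleftrightarrow> (\<exists>\<psi>s. set \<psi>s \<subseteq> \<Gamma> \<and> Hbp N (foldr Imp \<psi>s \<phi>))"

(* Falsum is not primitive, so inconsistency is deriving some formula and its negation. *)
definition consistent :: "'a set \<Rightarrow> ('p, 'a) fm set \<Rightarrow> bool" where
  "consistent N \<Gamma> \<longleftrightarrow>
    \<not> (\<exists>\<phi>. derives_from N \<Gamma> \<phi> \<and> derives_from N \<Gamma> (Neg \<phi>))"

definition max_consistent :: "'a set \<Rightarrow> ('p, 'a) fm set \<Rightarrow> bool" where
  "max_consistent N \<Gamma> \<longleftrightarrow>
    \<Gamma> \<subseteq> lang N \<and> consistent N \<Gamma> \<and>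
    (\<forall>\<Delta>. \<Gamma> \<subset> \<Delta> \<and> \<Delta> \<subseteq> lang N \<longrightarrow> \<not> consistent N \<Delta>)"

definition canon_worlds :: "'a set \<Rightarrow> ('p, 'a) fm set set" where
  "canon_worlds N = {\<Gamma>. max_consistent N \<Gamma>}"

definition canon_rel ::
  "'a set \<Rightarrow> 'a set \<Rightarrow> (('p, 'a) fm set \<times> ('p, 'a) fm set) set" where
  "canon_rel N C = {(\<Gamma>, \<Delta>). \<Gamma> \<in> canon_worlds N \<and> \<Delta> \<in> canon_worlds N \<and>
    (\<forall>\<phi>\<in>\<Delta>. Dia C \<phi> \<in> \<Gamma>)}"

definition canon_frame :: "'a set \<Rightarrow> ('a, ('p, 'a) fm set) frame" where
  "canon_frame N = (canon_worlds N, canon_rel N)"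

definition canon_val :: "'a set \<Rightarrow> 'p \<Rightarrow> ('p, 'a) fm set set" where
  "canon_val N p = {\<Gamma> \<in> canon_worlds N. Atom p \<in> \<Gamma>}"

end

theory Submission
  imports Defs
begin

text \<open>
  Completeness is by canonicity. Each universal frame condition on the canonical frame can be read
  off from one axiom schema. The only existential frame condition, apart from nonemptiness, is that a step of \<open>C \<union> D\<close> from \<open>\<Gamma>\<close> to \<open>\<Delta>\<close> factors through some \<open>\<Theta>\<close>. By symmetry it suffices that
  \<open>\<Theta>\<close> extends \<open>{\<chi>. [C]\<chi> \<in> \<Gamma>} \<union> {\<chi>. [D]\<chi> \<in> \<Delta>}\<close>. Were this set inconsistent, there would be a
  single \<open>\<beta>\<close> with \<open>[D]\<beta> \<in> \<Delta>\<close> and \<open>[C]\<not>\<beta> \<in> \<Gamma>\<close>; but \<open>\<langle>C \<union> D\<rangle>[D]\<beta> \<in> \<Gamma>\<close> yields \<open>\<langle>C\<rangle>\<langle>D\<rangle>[D]\<beta> \<in> \<Gamma>\<close>,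
  hence \<open>\<langle>C\<rangle>\<beta> \<in> \<Gamma>\<close>, a contradiction.
\<close>

section \<open>Soundness\<close>

text \<open>Truth at a fixed world is itself a valuation of atoms and diamond formulas, so every
  tautology holds at every world.\<close>

lemma prop_eval_sat: "prop_eval (sat F V s) \<phi> \<longleftrightarrow> sat F V s \<phi>"
  by (induction \<phi>) auto

lemma DevD:
  assumes "(S, E) \<in> Dev N"
  shows "S \<noteq> {}"
    and "C \<subseteq> N \<Longrightarrow> equiv S (E C)"
    and "E {} = Id_on S"
    and "C \<subseteq> D \<Longrightarrow> D \<subseteq> N \<Longrightarrow> E C \<subseteq> E D"
    and "C \<subseteq> N \<Longrightarrow> D \<subseteq> N \<Longrightarrow> E C O E D = E (C \<union> D)"
  using assms unfolding Dev_def by auto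

lemma soundness:
  assumes "Hbp N \<phi>" and Dev: "(S, E) \<in> Dev N" and "s \<in> S"
  shows "sat (S, E) V s \<phi>"
  using assms(1,3)
proof (induction arbitrary: s)
  case (Taut \<phi>)
  then show ?case by (metis prop_eval_sat tautology_def)
next
  case (T C \<phi>)
  have "(s, s) \<in> E C" using DevD(2)[OF Dev \<open>C \<subseteq> N\<close>] T.prems by (auto elim!: equivE dest: refl_onD)
  then show ?case using T.prems by auto
next
  case (Empty \<phi>)
  then show ?case using DevD(3)[OF Dev] by auto
next
  case (Four C \<phi>)
  have "trans (E C)" using DevD(2)[OF Dev \<open>C \<subseteq> N\<close>] by (auto elim!: equivE)
  then show ?case by (auto dest: transD)
next
  case (Five C \<phi>)
  \<comment> \<open>Symmetry and transitivity together give the Euclidean property: two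
    \<open>C\<close>-successors of \<open>s\<close> see each other.\<close>
  have "trans (E C)" "sym (E C)" using DevD(2)[OF Dev \<open>C \<subseteq> N\<close>] by (auto elim!: equivE)
  then show ?case by simp (meson symD transD)
next
  case (Mono C D \<phi>)
  then show ?case using DevD(4)[OF Dev Mono.hyps(1,2)] by auto
next
  case (Comp C D \<phi>)
  have comp: "E (C \<union> D) = E C O E D" using DevD(5)[OF Dev Comp.hyps(1,2)] by simp
  have "equiv S (E C)" using DevD(2)[OF Dev \<open>C \<subseteq> N\<close>] .
  \<comment> \<open>The middle point supplied by relational composition must lie in
    \<open>S\<close>, because \<open>sat\<close> quantifies only over worlds of the frame.\<close>
  then have "E C \<subseteq> S \<times> S" by (simp add: equiv_type)
  then show ?case by (simp add: comp) blast
qed auto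

lemma unit_frame_in_Dev: "({()}, \<lambda>_. Id) \<in> Dev N"
  unfolding Dev_def by (auto intro!: equivI simp: refl_on_def sym_def trans_def)

section \<open>Derivability\<close>

lemma Hbp_lang: "Hbp N \<phi> \<Longrightarrow> \<phi> \<in> lang N"
  by (induction rule: Hbp.induct) (auto simp: lang_def)

lemma in_lang_foldr_Imp:
  "in_lang N (foldr Imp \<psi>s \<phi>) \<longleftrightarrow> (\<forall>\<psi>\<in>set \<psi>s. in_lang N \<psi>) \<and> in_lang N \<phi>"
  by (induction \<psi>s) auto

lemma prop_eval_foldr_Imp:
  "prop_eval v (foldr Imp \<psi>s \<phi>) \<longleftrightarrow> ((\<forall>\<psi>\<in>set \<psi>s. prop_eval v \<psi>) \<longrightarrow> prop_eval v \<phi>)"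
  by (induction \<psi>s) auto

lemma Hbp_foldr_Imp_MP:
  "\<lbrakk>Hbp N (foldr Imp \<psi>s \<phi>); \<forall>\<psi>\<in>set \<psi>s. Hbp N \<psi>\<rbrakk> \<Longrightarrow> Hbp N \<phi>"
  by (induction \<psi>s) (auto intro: Hbp.MP)

text \<open>All propositional reasoning among theorems passes through this rule: the chain of
  implications from \<open>\<psi>s\<close> to \<open>\<phi>\<close> is a tautology, and modus ponens
  discharges its premises. Derivations thus reduce to truth-table checks.\<close>

lemma Hbp_prop:
  assumes "\<forall>\<psi>\<in>set \<psi>s. Hbp N \<psi>" "in_lang N \<phi>"
    and "\<And>v. \<forall>\<psi>\<in>set \<psi>s. prop_eval v \<psi> \<Longrightarrow> prop_eval v \<phi>"
  shows "Hbp N \<phi>"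
proof (rule Hbp_foldr_Imp_MP)
  show "Hbp N (foldr Imp \<psi>s \<phi>)"
    using assms Hbp_lang
    by (intro Hbp.Taut) (auto simp: lang_def in_lang_foldr_Imp tautology_def prop_eval_foldr_Imp)
qed (use assms in auto)

lemma derives_from_Hbp: "Hbp N \<phi> \<Longrightarrow> derives_from N \<Gamma> \<phi>"
  unfolding derives_from_def by (rule exI[of _ "[]"]) simp

lemma derives_from_empty: "derives_from N {} \<phi> \<longleftrightarrow> Hbp N \<phi>"
  unfolding derives_from_def by auto

lemma derives_from_lang: "derives_from N \<Gamma> \<phi> \<Longrightarrow> in_lang N \<phi>"
  unfolding derives_from_def using Hbp_lang by (fastforce simp: lang_def in_lang_foldr_Imp)

lemma derives_from_mono: "derives_from N \<Gamma> \<phi> \<Longrightarrow> \<Gamma> \<subseteq> \<Delta> \<Longrightarrow> derives_from N \<Delta> \<phi>"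
  unfolding derives_from_def by blast

lemma derives_from_member:
  assumes "\<phi> \<in> \<Gamma>" "in_lang N \<phi>"
  shows "derives_from N \<Gamma> \<phi>"
proof -
  have "Hbp N (foldr Imp [\<phi>] \<phi>)"
    using assms by (intro Hbp.Taut) (auto simp: lang_def tautology_def)
  then show ?thesis unfolding derives_from_def using assms by (intro exI[of _ "[\<phi>]"]) simp
qed

lemma derives_from_MP:
  assumes "derives_from N \<Gamma> (Imp \<phi> \<psi>)" "derives_from N \<Gamma> \<phi>"
  shows "derives_from N \<Gamma> \<psi>"
proof -
  obtain as bs where as: "set as \<subseteq> \<Gamma>" "Hbp N (foldr Imp as (Imp \<phi> \<psi>))"
    and bs: "set bs \<subseteq> \<Gamma>" "Hbp N (foldr Imp bs \<phi>)"
    using assms unfolding derives_from_def by blast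
  have "Hbp N (foldr Imp (as @ bs) \<psi>)"
    \<comment> \<open>\<open>as @ bs\<close> is kept whole so that its formulas are treated as the
      premises of a single implication chain.\<close>
    using as bs Hbp_lang[OF as(2)] Hbp_lang[OF bs(2)]
    by (intro Hbp_prop[of "[foldr Imp as (Imp \<phi> \<psi>), foldr Imp bs \<phi>]"])
      (auto simp: lang_def in_lang_foldr_Imp prop_eval_foldr_Imp simp del: foldr_append)
  then show ?thesis unfolding derives_from_def using as(1) bs(1)
    by (intro exI[of _ "as @ bs"]) simp
qed

lemma derives_from_foldr_Imp_MP:
  "\<lbrakk>derives_from N \<Gamma> (foldr Imp \<psi>s \<phi>); \<forall>\<psi>\<in>set \<psi>s. derives_from N \<Gamma> \<psi>\<rbrakk> \<Longrightarrow> derives_from N \<Gamma> \<phi>"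
  by (induction \<psi>s) (auto intro: derives_from_MP)

text \<open>The same truth-table principle as \<open>Hbp_prop\<close>, now relative to a set of
  hypotheses.\<close>

lemma derives_from_prop:
  assumes "\<forall>\<psi>\<in>set \<psi>s. derives_from N \<Gamma> \<psi>" "in_lang N \<phi>"
    and "\<And>v. \<forall>\<psi>\<in>set \<psi>s. prop_eval v \<psi> \<Longrightarrow> prop_eval v \<phi>"
  shows "derives_from N \<Gamma> \<phi>"
proof (rule derives_from_foldr_Imp_MP)
  have "\<forall>\<psi>\<in>set \<psi>s. in_lang N \<psi>" using assms(1) derives_from_lang by blast
  then show "derives_from N \<Gamma> (foldr Imp \<psi>s \<phi>)"
    using assms
    by (intro derives_from_Hbp Hbp.Taut)
      (auto simp: lang_def in_lang_foldr_Imp tautology_def prop_eval_foldr_Imp)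
qed (use assms in auto)

lemma inconsistent_derives:
  assumes "\<not> consistent N \<Gamma>" "in_lang N \<phi>"
  shows "derives_from N \<Gamma> \<phi>"
proof -
  obtain \<psi> where "derives_from N \<Gamma> \<psi>" "derives_from N \<Gamma> (Neg \<psi>)"
    using assms unfolding consistent_def by blast
  then show ?thesis using assms by (intro derives_from_prop[of "[\<psi>, Neg \<psi>]"]) auto
qed

text \<open>Here \<open>B\<close> contributes a single formula \<open>\<beta>\<close>, the conjunction of all the premises taken from it.\<close>

lemma derives_from_Un:
  assumes "derives_from N (A \<union> B) \<phi>" "B \<subseteq> lang N"
  obtains \<beta> where "derives_from N B \<beta>" "derives_from N A (Imp \<beta> \<phi>)"
proof -
  obtain \<psi>s where \<psi>s: "set \<psi>s \<subseteq> A \<union> B" "Hbp N (foldr Imp \<psi>s \<phi>)"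
    using assms unfolding derives_from_def by blast
  define bs where "bs = filter (\<lambda>\<psi>. \<psi> \<in> B) \<psi>s"
  \<comment> \<open>Formulas lying in both sets count as members of \<open>B\<close>; what remains
    must come from \<open>A\<close>.\<close>
  define as where "as = filter (\<lambda>\<psi>. \<psi> \<notin> B) \<psi>s"
  \<comment> \<open>This is the negation of "\<open>bs\<close> implies falsum", which also makes
    sense for empty \<open>bs\<close>, where it is a tautology. Falsum is built from
    \<open>\<phi>\<close>, so \<open>\<beta>\<close> stays in the language.\<close>
  define \<beta> where "\<beta> = Neg (foldr Imp bs (And \<phi> (Neg \<phi>)))"
  have lang: "in_lang N \<phi>" "\<forall>\<psi>\<in>set \<psi>s. in_lang N \<psi>"
    using Hbp_lang[OF \<psi>s(2)] by (auto simp: lang_def in_lang_foldr_Imp)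
  have "in_lang N \<beta>" using lang by (auto simp: \<beta>_def bs_def in_lang_foldr_Imp)
  have eval: "prop_eval v \<beta> \<longleftrightarrow> (\<forall>\<psi>\<in>set bs. prop_eval v \<psi>)" for v
    by (simp add: \<beta>_def prop_eval_foldr_Imp)
  have "derives_from N B \<beta>"
  proof (rule derives_from_prop[of bs])
    show "\<forall>\<psi>\<in>set bs. derives_from N B \<psi>"
      using lang by (auto simp: bs_def intro: derives_from_member)
  qed (use eval \<open>in_lang N \<beta>\<close> in auto)
  moreover have "Hbp N (foldr Imp as (Imp \<beta> \<phi>))"
    using \<psi>s lang \<open>in_lang N \<beta>\<close>
    by (intro Hbp_prop[of "[foldr Imp \<psi>s \<phi>]"])
      (auto simp: in_lang_foldr_Imp prop_eval_foldr_Imp eval as_def bs_def)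
  then have "derives_from N A (Imp \<beta> \<phi>)"
    unfolding derives_from_def using \<psi>s(1) by (intro exI[of _ as]) (auto simp: as_def)
  ultimately show thesis using that by blast
qed

text \<open>An inconsistent union is separated by a single formula, obtained by splitting a
  derivation of falsum. This is what turns the consistency question in
  \<open>canon_rel_factor\<close> into one about single boxed formulas.\<close>

lemma inconsistent_Un:
  assumes "\<not> consistent N (A \<union> B)" "B \<subseteq> lang N"
  obtains \<beta> where "derives_from N B \<beta>" "derives_from N A (Neg \<beta>)"
proof -
  \<comment> \<open>Any atom serves here, since atoms belong to the language for every
    \<open>N\<close>.\<close>
  define bot :: "('b, 'a) fm" where "bot = And (Atom undefined) (Neg (Atom undefined))"
  have "derives_from N (A \<union> B) bot"
    using assms(1) by (rule inconsistent_derives) (simp add: bot_def)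
  then obtain \<beta> where \<beta>: "derives_from N B \<beta>" "derives_from N A (Imp \<beta> bot)"
    using derives_from_Un assms(2) by blast
  then have "derives_from N A (Neg \<beta>)"
    using derives_from_lang[OF \<beta>(1)]
    by (intro derives_from_prop[of "[Imp \<beta> bot]"]) (auto simp: bot_def)
  with \<beta>(1) show thesis using that by blast
qed

text \<open>With \<open>{\<phi>}\<close> as the second set, the separating formula
  \<open>\<beta>\<close> follows from \<open>\<phi>\<close> alone, so refuting
  \<open>\<beta>\<close> refutes \<open>\<phi>\<close>.\<close>

lemma inconsistent_insert:
  assumes "\<not> consistent N (insert \<phi> \<Gamma>)" "in_lang N \<phi>"
  shows "derives_from N \<Gamma> (Neg \<phi>)"
proof -
  have "\<not> consistent N (\<Gamma> \<union> {\<phi>})" "{\<phi>} \<subseteq> lang N" using assms by (auto simp: lang_def)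
  then obtain \<beta> where \<beta>: "derives_from N {\<phi>} \<beta>" "derives_from N \<Gamma> (Neg \<beta>)"
    using inconsistent_Un by blast
  obtain \<psi>s where \<psi>s: "set \<psi>s \<subseteq> {\<phi>}" "Hbp N (foldr Imp \<psi>s \<beta>)"
    using \<beta>(1) unfolding derives_from_def by blast
  then show ?thesis using \<beta>(2) assms(2) derives_from_Hbp[OF \<psi>s(2)]
    by (intro derives_from_prop[of "[foldr Imp \<psi>s \<beta>, Neg \<beta>]"])
      (auto simp: prop_eval_foldr_Imp)
qed

lemma not_Hbp_consistent:
  assumes "in_lang N \<phi>" "\<not> Hbp N \<phi>"
  shows "consistent N {Neg \<phi>}"
proof (rule ccontr)
  assume "\<not> ?thesis"
  then have "derives_from N {} (Neg (Neg \<phi>))" using assms by (intro inconsistent_insert) auto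
  then have "derives_from N {} \<phi>"
    using assms by (intro derives_from_prop[of "[Neg (Neg \<phi>)]"]) auto
  then show False using assms by (simp add: derives_from_empty)
qed

text \<open>Soundness on the one-point frame rules out proving both a formula and its negation. This
  later makes the set of canonical worlds nonempty.\<close>

lemma consistent_empty:
  fixes N :: "'a set"
  shows "consistent N ({} :: ('p, 'a) fm set)"
  unfolding consistent_def derives_from_empty
proof
  assume "\<exists>\<phi> :: ('p, 'a) fm. Hbp N \<phi> \<and> Hbp N (Neg \<phi>)"
  then obtain \<phi> :: "('p, 'a) fm" where "Hbp N \<phi>" "Hbp N (Neg \<phi>)" by blast
  then have "sat ({()}, \<lambda>_. Id) (\<lambda>_. {}) () \<phi>" "sat ({()}, \<lambda>_. Id) (\<lambda>_. {}) () (Neg \<phi>)"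
    by (auto intro!: soundness[OF _ unit_frame_in_Dev] simp del: sat.simps)
  then show False by simp
qed

section \<open>Maximal consistent sets\<close>

lemma derives_from_finite:
  assumes "derives_from N \<Gamma> \<phi>"
  obtains \<Gamma>' where "finite \<Gamma>'" "\<Gamma>' \<subseteq> \<Gamma>" "derives_from N \<Gamma>' \<phi>"
  using assms unfolding derives_from_def by (metis List.finite_set order_refl)

text \<open>Zorn's lemma applies to the consistent extensions of \<open>\<Gamma>\<close> within the
  language: an inconsistency of the union of a chain uses finitely many premises, and these already
  lie in one member of the chain.\<close>

lemma Lindenbaum:
  assumes "\<Gamma> \<subseteq> lang N" "consistent N \<Gamma>"
  obtains \<Delta> where "\<Gamma> \<subseteq> \<Delta>" "max_consistent N \<Delta>"
proof -
  define \<A> where "\<A> = {\<Delta>. \<Gamma> \<subseteq> \<Delta> \<and> \<Delta> \<subseteq> lang N \<and> consistent N \<Delta>}"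
  have "\<exists>M\<in>\<A>. \<forall>X\<in>\<A>. M \<subseteq> X \<longrightarrow> X = M"
  proof (rule subset_Zorn_nonempty)
    show "\<A> \<noteq> {}" using assms by (auto simp: \<A>_def)
  next
    fix \<C> assume "\<C> \<noteq> {}" and chain: "subset.chain \<A> \<C>"
    then have sub: "\<C> \<subseteq> \<A>" by (auto simp: subset.chain_def)
    have "consistent N (\<Union>\<C>)"
    proof (rule ccontr)
      assume "\<not> ?thesis"
      then obtain \<phi> where \<phi>: "derives_from N (\<Union>\<C>) \<phi>" "derives_from N (\<Union>\<C>) (Neg \<phi>)"
        unfolding consistent_def by blast
      obtain X where X: "finite X" "X \<subseteq> \<Union>\<C>" "derives_from N X \<phi>"
        using derives_from_finite[OF \<phi>(1)] .
      obtain Y where Y: "finite Y" "Y \<subseteq> \<Union>\<C>" "derives_from N Y (Neg \<phi>)"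
        using derives_from_finite[OF \<phi>(2)] .
      obtain \<Delta> where "\<Delta> \<in> \<C>" "X \<union> Y \<subseteq> \<Delta>"
        using finite_subset_Union_chain[of "X \<union> Y" \<C> \<A>] X(1,2) Y(1,2) \<open>\<C> \<noteq> {}\<close> chain
        by (metis Un_least finite_UnI)
      moreover from this have "derives_from N \<Delta> \<phi>" "derives_from N \<Delta> (Neg \<phi>)"
        using derives_from_mono[OF X(3)] derives_from_mono[OF Y(3)] by auto
      ultimately show False using sub unfolding \<A>_def consistent_def by blast
    qed
    then show "\<Union>\<C> \<in> \<A>" using sub \<open>\<C> \<noteq> {}\<close> by (auto simp: \<A>_def)
  qed
  then obtain \<Delta> where \<Delta>: "\<Delta> \<in> \<A>" "\<forall>X\<in>\<A>. \<Delta> \<subseteq> X \<longrightarrow> X = \<Delta>" by blast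
  have "\<not> consistent N X" if "\<Delta> \<subset> X" "X \<subseteq> lang N" for X
  proof
    assume "consistent N X"
    then have "X \<in> \<A>" using \<Delta>(1) that by (auto simp: \<A>_def)
    then show False using \<Delta>(2) that(1) by blast
  qed
  then have "max_consistent N \<Delta>" using \<Delta>(1) by (simp add: max_consistent_def \<A>_def)
  with \<Delta>(1) show thesis using that by (auto simp: \<A>_def)
qed

section \<open>Propositional and modal closure of a maximal consistent set\<close>

context
  fixes N :: "'a set" and \<Gamma> :: "('p, 'a) fm set"
  assumes mcs: "max_consistent N \<Gamma>"
begin

lemma mcs_in_lang: "\<phi> \<in> \<Gamma> \<Longrightarrow> in_lang N \<phi>"
  using mcs by (auto simp: max_consistent_def lang_def)

text \<open>If \<open>\<phi>\<close> were missing, adding it would be inconsistent by maximality, so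
  \<open>\<Gamma>\<close> would derive both \<open>\<phi>\<close> and its negation.\<close>

lemma mcs_derives:
  assumes "derives_from N \<Gamma> \<phi>"
  shows "\<phi> \<in> \<Gamma>"
proof (rule ccontr)
  assume "\<phi> \<notin> \<Gamma>"
  have "in_lang N \<phi>" using assms derives_from_lang by blast
  then have "insert \<phi> \<Gamma> \<subseteq> lang N" "\<Gamma> \<subset> insert \<phi> \<Gamma>"
    using mcs \<open>\<phi> \<notin> \<Gamma>\<close> by (auto simp: max_consistent_def lang_def)
  then have "\<not> consistent N (insert \<phi> \<Gamma>)" using mcs unfolding max_consistent_def by blast
  then have "derives_from N \<Gamma> (Neg \<phi>)" using \<open>in_lang N \<phi>\<close> by (rule inconsistent_insert)
  then show False using mcs assms unfolding max_consistent_def consistent_def by blast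
qed

lemma mcs_Hbp: "Hbp N \<phi> \<Longrightarrow> \<phi> \<in> \<Gamma>"
  by (simp add: derives_from_Hbp mcs_derives)

lemma mcs_prop:
  assumes "set \<psi>s \<subseteq> \<Gamma>" "in_lang N \<phi>"
    and "\<And>v. \<forall>\<psi>\<in>set \<psi>s. prop_eval v \<psi> \<Longrightarrow> prop_eval v \<phi>"
  shows "\<phi> \<in> \<Gamma>"
proof (rule mcs_derives, rule derives_from_prop)
  show "\<forall>\<psi>\<in>set \<psi>s. derives_from N \<Gamma> \<psi>"
    using assms(1) mcs_in_lang derives_from_member by blast
qed (use assms in auto)

lemma mcs_Neg:
  assumes "in_lang N \<phi>"
  shows "Neg \<phi> \<in> \<Gamma> \<longleftrightarrow> \<phi> \<notin> \<Gamma>"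
proof
  assume "Neg \<phi> \<in> \<Gamma>"
  then have "derives_from N \<Gamma> (Neg \<phi>)" using mcs_in_lang by (intro derives_from_member)
  then have "\<not> derives_from N \<Gamma> \<phi>"
    using mcs unfolding max_consistent_def consistent_def by blast
  then show "\<phi> \<notin> \<Gamma>" using assms derives_from_member by blast
next
  assume "\<phi> \<notin> \<Gamma>"
  then have "insert \<phi> \<Gamma> \<subseteq> lang N" "\<Gamma> \<subset> insert \<phi> \<Gamma>"
    using mcs assms by (auto simp: max_consistent_def lang_def)
  then have "\<not> consistent N (insert \<phi> \<Gamma>)" using mcs unfolding max_consistent_def by blast
  then show "Neg \<phi> \<in> \<Gamma>" using assms by (intro mcs_derives inconsistent_insert)
qed

lemma mcs_And:
  assumes "in_lang N \<phi>" "in_lang N \<psi>"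
  shows "And \<phi> \<psi> \<in> \<Gamma> \<longleftrightarrow> \<phi> \<in> \<Gamma> \<and> \<psi> \<in> \<Gamma>"
proof (intro iffI conjI)
  assume "And \<phi> \<psi> \<in> \<Gamma>"
  then show "\<phi> \<in> \<Gamma>" "\<psi> \<in> \<Gamma>" using assms by (auto intro: mcs_prop[of "[And \<phi> \<psi>]"])
next
  assume "\<phi> \<in> \<Gamma> \<and> \<psi> \<in> \<Gamma>"
  then show "And \<phi> \<psi> \<in> \<Gamma>" using assms by (intro mcs_prop[of "[\<phi>, \<psi>]"]) auto
qed

lemma mcs_Imp:
  assumes "Imp \<phi> \<psi> \<in> \<Gamma>" "\<phi> \<in> \<Gamma>"
  shows "\<psi> \<in> \<Gamma>"
  using assms mcs_in_lang[OF assms(1)] by (intro mcs_prop[of "[Imp \<phi> \<psi>, \<phi>]"]) auto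

lemma mcs_Iff:
  assumes "Iff \<phi> \<psi> \<in> \<Gamma>"
  shows "\<phi> \<in> \<Gamma> \<longleftrightarrow> \<psi> \<in> \<Gamma>"
proof -
  have "Imp \<phi> \<psi> \<in> \<Gamma>" "Imp \<psi> \<phi> \<in> \<Gamma>" using assms mcs_in_lang[OF assms] mcs_And by auto
  then show ?thesis using mcs_Imp by blast
qed

text \<open>\<open>Box C (Neg \<phi>)\<close> unfolds to the negation of
  \<open>Dia C (Neg (Neg \<phi>))\<close>, not of \<open>Dia C \<phi>\<close>; the
  \<open>Dual\<close> axiom bridges the double negation.\<close>

lemma mcs_Box_Neg:
  assumes "C \<subseteq> N" "in_lang N \<phi>"
  shows "Box C (Neg \<phi>) \<in> \<Gamma> \<longleftrightarrow> Dia C \<phi> \<notin> \<Gamma>"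
proof -
  have "Dia C \<phi> \<in> \<Gamma> \<longleftrightarrow> Neg (Box C (Neg \<phi>)) \<in> \<Gamma>"
    using assms by (intro mcs_Iff mcs_Hbp Hbp.Dual) (auto simp: lang_def)
  then show ?thesis using assms by (subst (asm) mcs_Neg) auto
qed

lemma mcs_Box_K:
  assumes "Box C (Imp \<phi> \<psi>) \<in> \<Gamma>" "Box C \<phi> \<in> \<Gamma>"
  shows "Box C \<psi> \<in> \<Gamma>"
proof -
  have "Imp (Box C (Imp \<phi> \<psi>)) (Imp (Box C \<phi>) (Box C \<psi>)) \<in> \<Gamma>"
    using mcs_in_lang[OF assms(1)] by (intro mcs_Hbp Hbp.K) (auto simp: lang_def)
  then show ?thesis using assms mcs_Imp by blast
qed

lemma mcs_T:
  assumes "C \<subseteq> N" "\<phi> \<in> \<Gamma>"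
  shows "Dia C \<phi> \<in> \<Gamma>"
proof (rule ccontr)
  have "in_lang N \<phi>" using assms mcs_in_lang by blast
  assume "Dia C \<phi> \<notin> \<Gamma>"
  then have "Box C (Neg \<phi>) \<in> \<Gamma>" using assms \<open>in_lang N \<phi>\<close> mcs_Box_Neg by blast
  moreover have "Imp (Box C (Neg \<phi>)) (Neg \<phi>) \<in> \<Gamma>"
    using assms \<open>in_lang N \<phi>\<close> by (intro mcs_Hbp Hbp.T) (auto simp: lang_def)
  ultimately have "Neg \<phi> \<in> \<Gamma>" using mcs_Imp by blast
  then show False using mcs_Neg \<open>in_lang N \<phi>\<close> assms by blast
qed

lemma mcs_Empty:
  assumes "Dia {} \<phi> \<in> \<Gamma>"
  shows "\<phi> \<in> \<Gamma>"
proof (rule ccontr)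
  have "in_lang N \<phi>" using mcs_in_lang[OF assms] by simp
  assume "\<phi> \<notin> \<Gamma>"
  then have "Neg \<phi> \<in> \<Gamma>" using mcs_Neg \<open>in_lang N \<phi>\<close> by blast
  moreover have "Box {} (Neg \<phi>) \<in> \<Gamma> \<longleftrightarrow> Neg \<phi> \<in> \<Gamma>"
    using \<open>in_lang N \<phi>\<close> by (intro mcs_Iff mcs_Hbp Hbp.Empty) (auto simp: lang_def)
  ultimately show False using mcs_Box_Neg[of "{}"] \<open>in_lang N \<phi>\<close> assms by blast
qed

lemma mcs_Comp:
  assumes "C \<subseteq> N" "D \<subseteq> N" "in_lang N \<phi>"
  shows "Dia C (Dia D \<phi>) \<in> \<Gamma> \<longleftrightarrow> Dia (C \<union> D) \<phi> \<in> \<Gamma>"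
  using assms by (intro mcs_Iff mcs_Hbp Hbp.Comp) (auto simp: lang_def)

lemma mcs_Mono:
  assumes "C \<subseteq> D" "D \<subseteq> N" "Dia C \<phi> \<in> \<Gamma>"
  shows "Dia D \<phi> \<in> \<Gamma>"
proof -
  have "Imp (Dia C \<phi>) (Dia D \<phi>) \<in> \<Gamma>"
    using assms mcs_in_lang[OF assms(3)] by (intro mcs_Hbp Hbp.Mono) (auto simp: lang_def)
  then show ?thesis using assms mcs_Imp by blast
qed

text \<open>This is axiom 5 at \<open>Neg \<phi>\<close>, in effect \<open>[C]<C>\<phi>\<close>. The
  inner diamond keeps the form of a negated box so that the result speaks directly about
  \<open>boxes\<close>.\<close>

lemma mcs_Five:
  assumes "C \<subseteq> N" "Dia C \<phi> \<in> \<Gamma>"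
  shows "Box C (Neg (Box C (Neg \<phi>))) \<in> \<Gamma>"
proof -
  have lang: "in_lang N \<phi>" using mcs_in_lang[OF assms(2)] by simp
  have "Imp (Neg (Box C (Neg \<phi>))) (Box C (Neg (Box C (Neg \<phi>)))) \<in> \<Gamma>"
    using assms lang by (intro mcs_Hbp Hbp.Five) (auto simp: lang_def)
  moreover have "Neg (Box C (Neg \<phi>)) \<in> \<Gamma>"
    using assms lang mcs_Box_Neg[OF assms(1) lang] by (subst mcs_Neg) auto
  ultimately show ?thesis using mcs_Imp by blast
qed

end

section \<open>The canonical frame\<close>

definition boxes :: "'a set \<Rightarrow> 'a set \<Rightarrow> ('p, 'a) fm set \<Rightarrow> ('p, 'a) fm set" where
  "boxes N C \<Gamma> = {\<phi> \<in> lang N. Box C \<phi> \<in> \<Gamma>}"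

text \<open>Necessitation boxes the whole implication chain, and \<open>K\<close> then strips off
  the premises one at a time.\<close>

lemma boxes_derives:
  assumes "max_consistent N \<Gamma>" "C \<subseteq> N" "derives_from N (boxes N C \<Gamma>) \<phi>"
  shows "Box C \<phi> \<in> \<Gamma>"
proof -
  obtain \<psi>s where \<psi>s: "set \<psi>s \<subseteq> boxes N C \<Gamma>" "Hbp N (foldr Imp \<psi>s \<phi>)"
    using assms(3) unfolding derives_from_def by blast
  have "Box C (foldr Imp \<psi>s \<phi>) \<in> \<Gamma>"
    using assms \<psi>s by (intro mcs_Hbp Hbp.Nec)
  then show ?thesis using \<psi>s(1)
  proof (induction \<psi>s)
    case (Cons \<psi> \<psi>s)
    then have "Box C \<psi> \<in> \<Gamma>" by (simp add: boxes_def)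
    moreover have "Box C (Imp \<psi> (foldr Imp \<psi>s \<phi>)) \<in> \<Gamma>" using Cons.prems by simp
    ultimately have "Box C (foldr Imp \<psi>s \<phi>) \<in> \<Gamma>" using mcs_Box_K[OF assms(1)] by blast
    then show ?case using Cons by simp
  qed simp
qed

text \<open>The diamond form of the canonical relation suits reading off axioms, the box form suits
  building worlds with \<open>Lindenbaum\<close>. Both directions argue by contradiction, using that
  a maximal consistent set decides every formula of the language.\<close>

lemma canon_rel_iff:
  assumes "C \<subseteq> N"
  shows "(\<Gamma>, \<Delta>) \<in> canon_rel N C \<longleftrightarrow>
    max_consistent N \<Gamma> \<and> max_consistent N \<Delta> \<and> boxes N C \<Gamma> \<subseteq> \<Delta>"
proof (cases "max_consistent N \<Gamma> \<and> max_consistent N \<Delta>")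
  case True
  then have \<Gamma>: "max_consistent N \<Gamma>" and \<Delta>: "max_consistent N \<Delta>" by auto
  have "(\<forall>\<phi>\<in>\<Delta>. Dia C \<phi> \<in> \<Gamma>) \<longleftrightarrow> boxes N C \<Gamma> \<subseteq> \<Delta>"
  proof (intro iffI subsetI ballI)
    fix \<phi> assume *: "\<forall>\<phi>\<in>\<Delta>. Dia C \<phi> \<in> \<Gamma>" "\<phi> \<in> boxes N C \<Gamma>"
    then have lang: "in_lang N \<phi>" and box: "Box C \<phi> \<in> \<Gamma>" by (auto simp: boxes_def lang_def)
    show "\<phi> \<in> \<Delta>"
    proof (rule ccontr)
      assume "\<phi> \<notin> \<Delta>"
      then have "Dia C (Neg \<phi>) \<in> \<Gamma>" using * lang mcs_Neg[OF \<Delta>] by blast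
      then show False using box mcs_Neg[OF \<Gamma>] mcs_in_lang[OF \<Gamma>] by blast
    qed
  next
    fix \<phi> assume *: "boxes N C \<Gamma> \<subseteq> \<Delta>" "\<phi> \<in> \<Delta>"
    have lang: "in_lang N \<phi>" using mcs_in_lang[OF \<Delta> *(2)] .
    show "Dia C \<phi> \<in> \<Gamma>"
    proof (rule ccontr)
      assume "Dia C \<phi> \<notin> \<Gamma>"
      then have "Neg \<phi> \<in> boxes N C \<Gamma>"
        using mcs_Box_Neg[OF \<Gamma> assms lang] lang by (auto simp: boxes_def lang_def)
      then show False using * mcs_Neg[OF \<Delta> lang] by blast
    qed
  qed
  then show ?thesis using True by (simp add: canon_rel_def canon_worlds_def)
qed (auto simp: canon_rel_def canon_worlds_def)

lemma canon_rel_Dia: "(\<Gamma>, \<Delta>) \<in> canon_rel N C \<Longrightarrow> \<phi> \<in> \<Delta> \<Longrightarrow> Dia C \<phi> \<in> \<Gamma>"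
  by (simp add: canon_rel_def)

lemma canon_rel_mcs:
  assumes "(\<Gamma>, \<Delta>) \<in> canon_rel N C"
  shows "max_consistent N \<Gamma>" "max_consistent N \<Delta>"
  using assms by (auto simp: canon_rel_def canon_worlds_def)

text \<open>Existence lemma: if \<open>\<phi>\<close> were inconsistent with the formulas boxed in
  \<open>\<Gamma>\<close>, then \<open>[C]\<not>\<phi>\<close> would lie in \<open>\<Gamma>\<close>,
  against the diamond.\<close>

lemma canon_rel_exists:
  assumes \<Gamma>: "max_consistent N \<Gamma>" and C: "C \<subseteq> N" and dia: "Dia C \<phi> \<in> \<Gamma>"
  obtains \<Delta> where "(\<Gamma>, \<Delta>) \<in> canon_rel N C" "\<phi> \<in> \<Delta>"
proof -
  have lang: "in_lang N \<phi>" using mcs_in_lang[OF \<Gamma> dia] by simp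
  have "consistent N (insert \<phi> (boxes N C \<Gamma>))"
  proof (rule ccontr)
    assume "\<not> ?thesis"
    then have "Box C (Neg \<phi>) \<in> \<Gamma>" using lang \<Gamma> C inconsistent_insert boxes_derives by blast
    then show False using mcs_Box_Neg[OF \<Gamma> C lang] dia by blast
  qed
  moreover have "insert \<phi> (boxes N C \<Gamma>) \<subseteq> lang N" using lang by (auto simp: boxes_def lang_def)
  ultimately obtain \<Delta> where "insert \<phi> (boxes N C \<Gamma>) \<subseteq> \<Delta>" "max_consistent N \<Delta>"
    using Lindenbaum by blast
  then show thesis using that \<Gamma> canon_rel_iff[OF C] by blast
qed

text \<open>For \<open>\<phi>\<close> in \<open>\<Gamma>\<close>, T gives \<open><C>\<phi>\<close>
  in \<open>\<Gamma>\<close> and 5 boxes it, so it passes to \<open>\<Delta>\<close>.\<close>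

lemma canon_rel_sym:
  assumes C: "C \<subseteq> N" and rel: "(\<Gamma>, \<Delta>) \<in> canon_rel N C"
  shows "(\<Delta>, \<Gamma>) \<in> canon_rel N C"
proof -
  note \<Gamma> = canon_rel_mcs(1)[OF rel] and \<Delta> = canon_rel_mcs(2)[OF rel]
  have "Dia C \<phi> \<in> \<Delta>" if "\<phi> \<in> \<Gamma>" for \<phi>
  proof -
    have lang: "in_lang N \<phi>" using mcs_in_lang[OF \<Gamma> that] .
    have "Box C (Neg (Box C (Neg \<phi>))) \<in> \<Gamma>" using mcs_Five[OF \<Gamma> C mcs_T[OF \<Gamma> C that]] .
    then have "Neg (Box C (Neg \<phi>)) \<in> boxes N C \<Gamma>" using C lang by (simp add: boxes_def lang_def)
    then have "Neg (Box C (Neg \<phi>)) \<in> \<Delta>" using rel canon_rel_iff[OF C] by blast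
    then have "Box C (Neg \<phi>) \<notin> \<Delta>" using mcs_Neg[OF \<Delta>] mcs_in_lang[OF \<Delta>] by blast
    then show ?thesis using mcs_Box_Neg[OF \<Delta> C lang] by blast
  qed
  then show ?thesis using \<Gamma> \<Delta> by (simp add: canon_rel_def canon_worlds_def)
qed

lemma canon_rel_comp_subset:
  assumes "C \<subseteq> N" "D \<subseteq> N" "(\<Gamma>, \<Theta>) \<in> canon_rel N C" "(\<Theta>, \<Delta>) \<in> canon_rel N D"
  shows "(\<Gamma>, \<Delta>) \<in> canon_rel N (C \<union> D)"
proof -
  note \<Gamma> = canon_rel_mcs(1)[OF assms(3)] and \<Delta> = canon_rel_mcs(2)[OF assms(4)]
  have "Dia (C \<union> D) \<phi> \<in> \<Gamma>" if "\<phi> \<in> \<Delta>" for \<phi>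
    using mcs_Comp[OF \<Gamma> assms(1,2)] mcs_in_lang[OF \<Delta> that] that assms(3,4) canon_rel_Dia by blast
  then show ?thesis using \<Gamma> \<Delta> by (simp add: canon_rel_def canon_worlds_def)
qed

lemma canon_rel_factor:
  assumes C: "C \<subseteq> N" and D: "D \<subseteq> N" and rel: "(\<Gamma>, \<Delta>) \<in> canon_rel N (C \<union> D)"
  obtains \<Theta> where "(\<Gamma>, \<Theta>) \<in> canon_rel N C" "(\<Theta>, \<Delta>) \<in> canon_rel N D"
proof -
  note \<Gamma> = canon_rel_mcs(1)[OF rel] and \<Delta> = canon_rel_mcs(2)[OF rel]
  have lang: "boxes N C \<Gamma> \<subseteq> lang N" "boxes N D \<Delta> \<subseteq> lang N" by (auto simp: boxes_def)
  have "consistent N (boxes N C \<Gamma> \<union> boxes N D \<Delta>)"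
  proof (rule ccontr)
    assume "\<not> ?thesis"
    then obtain \<beta> where \<beta>: "derives_from N (boxes N D \<Delta>) \<beta>" "derives_from N (boxes N C \<Gamma>) (Neg \<beta>)"
      using inconsistent_Un lang(2) by blast
    then have \<beta>_lang: "in_lang N \<beta>" using derives_from_lang by blast
    have "Box D \<beta> \<in> \<Delta>" using boxes_derives[OF \<Delta> D \<beta>(1)] .
    then have "Dia (C \<union> D) (Box D \<beta>) \<in> \<Gamma>" using rel canon_rel_Dia by blast
    then have "Dia C (Dia D (Box D \<beta>)) \<in> \<Gamma>"
      using mcs_Comp[OF \<Gamma> C D, of "Box D \<beta>"] \<beta>_lang D by simp
    then obtain \<Theta> where \<Theta>: "(\<Gamma>, \<Theta>) \<in> canon_rel N C" "Dia D (Box D \<beta>) \<in> \<Theta>"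
      using canon_rel_exists[OF \<Gamma> C] by blast
    \<comment> \<open>The passage from \<open><D>[D]\<beta>\<close> to \<open>\<beta>\<close> is
      made with worlds: step to a \<open>D\<close>-successor containing \<open>[D]\<beta>\<close>
      and return by symmetry.\<close>
    obtain \<Psi> where \<Psi>: "(\<Theta>, \<Psi>) \<in> canon_rel N D" "Box D \<beta> \<in> \<Psi>"
      using canon_rel_exists[OF canon_rel_mcs(2)[OF \<Theta>(1)] D \<Theta>(2)] by blast
    have "\<beta> \<in> boxes N D \<Psi>" using \<Psi>(2) \<beta>_lang by (simp add: boxes_def lang_def)
    then have "\<beta> \<in> \<Theta>" using canon_rel_sym[OF D \<Psi>(1)] canon_rel_iff[OF D] by blast
    moreover have "Neg \<beta> \<in> boxes N C \<Gamma>"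
      using boxes_derives[OF \<Gamma> C \<beta>(2)] \<beta>_lang by (simp add: boxes_def lang_def)
    then have "Neg \<beta> \<in> \<Theta>" using \<Theta>(1) canon_rel_iff[OF C] by blast
    ultimately show False using mcs_Neg[OF canon_rel_mcs(2)[OF \<Theta>(1)] \<beta>_lang] by blast
  qed
  then obtain \<Theta> where \<Theta>: "boxes N C \<Gamma> \<union> boxes N D \<Delta> \<subseteq> \<Theta>" "max_consistent N \<Theta>"
    using Lindenbaum lang by (metis Un_least)
  have "(\<Gamma>, \<Theta>) \<in> canon_rel N C" "(\<Delta>, \<Theta>) \<in> canon_rel N D"
    using \<Theta> \<Gamma> \<Delta> canon_rel_iff[OF C] canon_rel_iff[OF D] by blast+
  then show thesis using that canon_rel_sym[OF D] by blast
qed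

lemma canon_rel_refl: "C \<subseteq> N \<Longrightarrow> max_consistent N \<Gamma> \<Longrightarrow> (\<Gamma>, \<Gamma>) \<in> canon_rel N C"
  by (simp add: canon_rel_def canon_worlds_def mcs_T)

lemma canon_rel_empty:
  "canon_rel N {} = (Id_on (canon_worlds N) :: (('p, 'a) fm set \<times> ('p, 'a) fm set) set)"
proof -
  have "\<Gamma> = \<Delta>" if rel: "(\<Gamma>, \<Delta>) \<in> canon_rel N {}" for \<Gamma> \<Delta> :: "('p, 'a) fm set"
  proof -
    note \<Gamma> = canon_rel_mcs(1)[OF rel] and \<Delta> = canon_rel_mcs(2)[OF rel]
    have "\<Delta> \<subseteq> \<Gamma>"
      by (rule subsetI, rule mcs_Empty[OF \<Gamma>], rule canon_rel_Dia[OF rel])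
    \<comment> \<open>The empty-coalition axiom yields only one inclusion; maximality of
      \<open>\<Delta>\<close> upgrades it to equality.\<close>
    moreover have "\<not> \<Delta> \<subset> \<Gamma>" using \<Gamma> \<Delta> unfolding max_consistent_def by blast
    ultimately show ?thesis by blast
  qed
  then show ?thesis
    using canon_rel_refl[of "{}" N] by (auto simp: canon_worlds_def dest: canon_rel_mcs)
qed

lemma canon_frame_in_Dev: "(canon_frame N :: ('a, ('p, 'a) fm set) frame) \<in> Dev N"
proof -
  let ?S = "canon_worlds N :: ('p, 'a) fm set set"
  let ?E = "canon_rel N :: 'a set \<Rightarrow> (('p, 'a) fm set \<times> ('p, 'a) fm set) set"
  have "?S \<noteq> {}"
    using Lindenbaum[OF _ consistent_empty] by (auto simp: canon_worlds_def)
  moreover have "equiv ?S (?E C)" if C: "C \<subseteq> N" for C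
  proof (rule equivI)
    show "?E C \<subseteq> ?S \<times> ?S" by (auto simp: canon_rel_def)
    show "refl_on ?S (?E C)"
      using canon_rel_refl[OF C] by (auto simp: refl_on_def canon_worlds_def)
    show "sym (?E C)" using canon_rel_sym[OF C] by (rule symI)
    \<comment> \<open>Transitivity is the composition law with both labels equal, as
      \<open>C \<union> C = C\<close>.\<close>
    show "trans (?E C)" using canon_rel_comp_subset[OF C C] by (auto intro: transI)
  qed
  moreover have "?E C \<subseteq> ?E D" if "C \<subseteq> D" "D \<subseteq> N" for C D
    using that mcs_Mono by (fastforce simp: canon_rel_def canon_worlds_def)
  moreover have "?E C O ?E D = ?E (C \<union> D)" if CD: "C \<subseteq> N" "D \<subseteq> N" for C D
  proof (intro equalityI subrelI)
    fix \<Gamma> \<Delta> :: "('p, 'a) fm set"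
    show "(\<Gamma>, \<Delta>) \<in> ?E (C \<union> D)" if "(\<Gamma>, \<Delta>) \<in> ?E C O ?E D"
      using that canon_rel_comp_subset[OF CD] by blast
    show "(\<Gamma>, \<Delta>) \<in> ?E C O ?E D" if "(\<Gamma>, \<Delta>) \<in> ?E (C \<union> D)"
      using canon_rel_factor[OF CD that] by blast
  qed
  ultimately show ?thesis
    unfolding canon_frame_def Dev_def by (simp add: canon_rel_empty)
qed

section \<open>Truth lemma and completeness\<close>

lemma truth:
  assumes "max_consistent N \<Gamma>" "in_lang N \<phi>"
  shows "sat (canon_frame N) (canon_val N) \<Gamma> \<phi> \<longleftrightarrow> \<phi> \<in> \<Gamma>"
  using assms
proof (induction \<phi> arbitrary: \<Gamma>)
  case (Atom p)
  then show ?case by (simp add: canon_val_def canon_worlds_def)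
next
  case (Neg \<phi>)
  then show ?case by (simp add: mcs_Neg)
next
  case (And \<phi> \<psi>)
  then show ?case by (simp add: mcs_And)
next
  case (Dia C \<phi>)
  then have C: "C \<subseteq> N" by simp
  have "sat (canon_frame N) (canon_val N) \<Gamma> (Dia C \<phi>) \<longleftrightarrow>
    (\<exists>\<Delta>. (\<Gamma>, \<Delta>) \<in> canon_rel N C \<and> sat (canon_frame N) (canon_val N) \<Delta> \<phi>)"
    by (auto simp: canon_frame_def canon_rel_def)
  also have "\<dots> \<longleftrightarrow> (\<exists>\<Delta>. (\<Gamma>, \<Delta>) \<in> canon_rel N C \<and> \<phi> \<in> \<Delta>)"
    using Dia.IH Dia.prems(2) canon_rel_mcs(2) by (metis in_lang.simps(4))
  \<comment> \<open>One direction is the definition of the canonical relation; the other takes its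
    witness from the existence lemma.\<close>
  also have "\<dots> \<longleftrightarrow> Dia C \<phi> \<in> \<Gamma>"
    by (metis canon_rel_exists[OF Dia.prems(1) C] canon_rel_Dia)
  finally show ?case .
qed

lemma consistent_satisfiable:
  assumes "in_lang N \<phi>" "consistent N {\<phi>}"
  shows "\<exists>\<Gamma>\<in>canon_worlds N. sat (canon_frame N) (canon_val N) \<Gamma> \<phi>"
proof -
  obtain \<Gamma> where "{\<phi>} \<subseteq> \<Gamma>" "max_consistent N \<Gamma>"
    using Lindenbaum[of "{\<phi>}" N] assms by (auto simp: lang_def)
  then show ?thesis using truth assms(1) by (auto simp: canon_worlds_def)
qed

lemma Hbp_Dev_valid: "Hbp N \<phi> \<Longrightarrow> Dev_valid TYPE('s) N \<phi>"
  by (auto simp: Dev_valid_def frame_valid_def intro: soundness)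

text \<open>The world type is fixed to sets of formulas because the countermodel is the canonical
  model, where the negation of an unprovable \<open>\<phi>\<close> holds at some world.\<close>

lemma Dev_valid_Hbp:
  fixes \<phi> :: "('p, 'a) fm"
  assumes "in_lang N \<phi>" "Dev_valid TYPE(('p, 'a) fm set) N \<phi>"
  shows "Hbp N \<phi>"
proof (rule ccontr)
  assume "\<not> Hbp N \<phi>"
  then obtain \<Gamma> :: "('p, 'a) fm set" where \<Gamma>: "\<Gamma> \<in> canon_worlds N"
    and "sat (canon_frame N) (canon_val N) \<Gamma> (Neg \<phi>)"
    using consistent_satisfiable[OF _ not_Hbp_consistent[OF assms(1)]] assms(1) by auto
  moreover have "frame_valid (canon_frame N :: ('a, ('p, 'a) fm set) frame) \<phi>"
    using assms(2) canon_frame_in_Dev unfolding Dev_valid_def by blast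
  then have "sat (canon_frame N) (canon_val N) \<Gamma> \<phi>"
    using \<Gamma> unfolding frame_valid_def by (auto simp: canon_frame_def canon_val_def)
  ultimately show False by simp
qed

text \<open>Validity is relative to a type of worlds. Soundness is therefore stated for an arbitrary
  type \<open>'s\<close>, while completeness assumes validity only on frames whose worlds are sets
  of formulas.\<close>

theorem theorem1:
  fixes N :: "'a set"
  assumes "finite N"
  shows "(\<forall>\<phi> \<in> (lang N :: ('p, 'a) fm set).
            (Hbp N \<phi> \<longrightarrow> Dev_valid TYPE('s) N \<phi>)
          \<and> (Hbp N \<phi> \<longleftrightarrow> Dev_valid TYPE(('p, 'a) fm set) N \<phi>))
       \<and> (canon_frame N :: ('a, ('p, 'a) fm set) frame) \<in> Dev N
       \<and> (\<forall>\<phi> \<in> (lang N :: ('p, 'a) fm set). consistent N {\<phi>} \<longrightarrow>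
            (\<exists>\<Gamma> \<in> canon_worlds N. sat (canon_frame N) (canon_val N) \<Gamma> \<phi>))"
proof (intro conjI ballI impI)
  fix \<phi> :: "('p, 'a) fm"
  assume "\<phi> \<in> lang N"
  then have lang: "in_lang N \<phi>" by (simp add: lang_def)
  show "Dev_valid TYPE('s) N \<phi>" if "Hbp N \<phi>" using Hbp_Dev_valid[OF that] .
  show "Hbp N \<phi> \<longleftrightarrow> Dev_valid TYPE(('p, 'a) fm set) N \<phi>"
    using Hbp_Dev_valid Dev_valid_Hbp[OF lang] by (rule iffI)
  show "\<exists>\<Gamma>\<in>canon_worlds N. sat (canon_frame N) (canon_val N) \<Gamma> \<phi>" if "consistent N {\<phi>}"
    using consistent_satisfiable[OF lang that] .
qed (rule canon_frame_in_Dev)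

end
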